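(* For every $\beta\ge 0$ and $h,f\in\mathbb{R}$, one has, as an identity in $[0,\infty]$ between functions of $\omega$, $$\mathbf{E}\,\mathcal{E}_{\beta,h,f}^{\omega,\tau}\big(\mathrm{card}\{n\ge 0 : X_n=0\}\big)=\mathcal{Z}_{\beta,h}^{\omega}(f),$$ where $\mathcal{Z}_{\beta,h}^{\omega}(f)$ is the grand canonical partition function of the random pinning model and $\mathcal{E}_{\beta,h,f}^{\omega,\tau}$ is the expectation for the random walk in sparse random environment with additional drift $f$.
   Context: $\mathbb{N}_0$ and $\mathbb{N}$ denote the non-negative and the positive integers. Random walk in a potential. Given a real sequence $V=(V_i)_{i\in\mathbb{Z}}$ with $V_0=0$, put $\Delta V_i:=V_i-V_{i-1}$. The random walk in potential $V$ is the Markov chain $X=(X_n)_{n\ge0}$ on $\mathbb{Z}$ started at $X_0=0$ with nearest-neighbour transition probabilities $p(i,i+1)=1-p(i,i-1)=\frac{1}{1+e^{\Delta V_i}}$, $i\in\mathbb{Z}$. Throughout, $V$ is assumed symmetric with respect to $-1/2$, i.e. $V_i=V_{-i-1}$ for all $i\geq 0$ (so $V_{-1}=0$); hence $V$ is determined by $(\Delta V_i)_{i\ge1}$. Its law is $\mathcal{P}_V$. Randomness. $\tau=\{\tau_i\}_{i\ge0}\subset\mathbb{N}_0$ is a renewal process: $\tau_0=0$ and the increments $(\tau_i-\tau_{i-1})_{i\ge1}$ are i.i.d. $\mathbb{N}$-valued random variables; its law and expectation are $\mathbf{P},\mathbf{E}$, and $\mathbf{P}(\tau_1=n)=L(n)n^{-(1+\alpha)}$,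 $n\in\mathbb{N}$, with $\alpha\ge0$ and $L$ slowly varying. $\omega=(\omega_i)_{i\ge1}$ is a sequence of i.i.d. real random variables, independent of $\tau$, with law and expectation $\mathbb{P},\mathbb{E}$, such that $\mathbb{E}(\omega_1)=0$ and $\mathbb{E}(e^{\beta\omega_1})<\infty$ for all $\beta\ge0$. Random walk in sparse random environment with drift. $\mathcal{P}_{\beta,h,f}^{\omega,\tau}$ (expectation $\mathcal{E}_{\beta,h,f}^{\omega,\tau}$) is the law $\mathcal{P}_V$ for the potential with $\Delta V_i=(h+\beta\omega_i)\mathbf{1}_{\{i\in\tau\}}-f$ for $i\ge1$. Random pinning model. $Z_{n,\omega}^{\beta,h}:=\mathbf{E}\big[\exp\big(\sum_{i=1}^n(\beta\omega_i+h)\mathbf{1}_{\{i\in\tau\}}\big)\big]$ for $n\ge1$, $Z_{0,\omega}^{\beta,h}:=1$, and $\mathcal{Z}_{\beta,h}^{\omega}(f):=\sum_{n\ge0}Z_{n,\omega}^{\beta,h}e^{-fn}\in[0,\infty]$ for $f\in\mathbb{R}$. *)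

theory Defs
  imports "HOL-Probability.Probability"
begin

definition walk_prob :: "(int \<Rightarrow> real) \<Rightarrow> int \<Rightarrow> real" where
  "walk_prob V i = 1 / (1 + exp (V i - V (i - 1)))"

definition walk_kernel :: "(int \<Rightarrow> real) \<Rightarrow> int \<Rightarrow> int pmf" where
  "walk_kernel V i = map_pmf (\<lambda>b. if b then i + 1 else i - 1) (bernoulli_pmf (walk_prob V i))"

lemma pmf_walk_kernel:
  "pmf (walk_kernel V i) j =
     (if j = i + 1 then walk_prob V i else if j = i - 1 then 1 - walk_prob V i else 0)"
proof -
  have p: "0 \<le> walk_prob V i" "walk_prob V i \<le> 1"
    by (auto simp: walk_prob_def add_pos_pos divide_simps)
  have inj: "inj (\<lambda>b. if b then i + 1 else i - 1)"
    by (auto simp: inj_def split: if_splits)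
  consider "j = i + 1" | "j = i - 1" | "j \<noteq> i + 1" "j \<noteq> i - 1" by blast
  then show ?thesis
  proof cases
    case 1
    then show ?thesis
      using pmf_map_inj'[OF inj, of "bernoulli_pmf (walk_prob V i)" True] p
      by (simp add: walk_kernel_def)
  next
    case 2
    then show ?thesis
      using pmf_map_inj'[OF inj, of "bernoulli_pmf (walk_prob V i)" False] p
      by (simp add: walk_kernel_def)
  next
    case 3
    then have "j \<notin> set_pmf (walk_kernel V i)"
      by (auto simp: walk_kernel_def)
    then show ?thesis
      using 3 by (simp add: set_pmf_iff)
  qed
qed

text \<open>The law of the \<open>n\<close>-th position given the earlier ones \<open>x 0, \<dots>, x (n - 1)\<close>; the law of the
  whole trajectory is obtained from it by the Ionescu-Tulcea extension.\<close>

definition walk_step :: "(int \<Rightarrow> real) \<Rightarrow> nat \<Rightarrow> (nat \<Rightarrow> int) \<Rightarrow> int measure" where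
  "walk_step V n x = measure_pmf (if n = 0 then return_pmf 0 else walk_kernel V (x (n - 1)))"

interpretation walk: Ionescu_Tulcea "walk_step V" "\<lambda>_. count_space UNIV" for V
proof (rule Ionescu_Tulcea.intro)
  fix n
  show "walk_step V n \<in> measurable (PiM {0..<n} (\<lambda>_. count_space UNIV)) (subprob_algebra (count_space UNIV))"
  proof (cases n)
    case 0
    have "walk_step V 0 = (\<lambda>_. measure_pmf (return_pmf 0))"
      by (simp add: fun_eq_iff walk_step_def)
    then show ?thesis
      unfolding 0 by (simp only:) (rule measurable_const, rule measure_pmf_in_subprob_algebra)
  next
    case (Suc m)
    have "(\<lambda>x. x m) \<in> measurable (PiM {0..<n} (\<lambda>_. count_space UNIV)) (count_space (UNIV :: int set))"
      using Suc by (intro measurable_component_singleton) simp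
    moreover have "(\<lambda>i. measure_pmf (walk_kernel V i)) \<in> measurable (count_space UNIV) (subprob_algebra (count_space UNIV))"
      by (simp add: measurable_count_space_eq1 measure_pmf_in_subprob_algebra)
    ultimately have "(\<lambda>x. measure_pmf (walk_kernel V (x m))) \<in>
        measurable (PiM {0..<n} (\<lambda>_. count_space UNIV)) (subprob_algebra (count_space UNIV))"
      by (rule measurable_compose)
    moreover have "walk_step V n = (\<lambda>x. measure_pmf (walk_kernel V (x m)))"
      using Suc by (simp add: fun_eq_iff walk_step_def)
    ultimately show ?thesis
      by simp
  qed
next
  fix n and x :: "nat \<Rightarrow> int"
  show "prob_space (walk_step V n x)"
    unfolding walk_step_def by (rule prob_space_measure_pmf)
qed

definition walk_law :: "(int \<Rightarrow> real) \<Rightarrow> (nat \<Rightarrow> int) measure" where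
  "walk_law V = walk.PF.lim V"

lemma sets_walk_law [measurable_cong]:
  "sets (walk_law V) = sets (\<Pi>\<^sub>M n\<in>UNIV. count_space UNIV)"
  by (simp add: walk_law_def walk.PF.sets_lim)

lemma space_walk_law: "space (walk_law V) = UNIV"
  using sets_eq_imp_space_eq[OF sets_walk_law] by (simp add: space_PiM)

lemma emeasure_walk_C:
  "emeasure (walk.C V 0 (Suc n) (\<lambda>_. undefined)) {restrict x {0..<Suc n}} =
     ennreal (indicator {0} (x 0) * (\<Prod>k<n. pmf (walk_kernel V (x k)) (x (Suc k))))"
proof (induction n)
  let ?u = "\<lambda>_::nat. undefined :: int"
  have meas: "{restrict x {0..<m}} \<in> sets (\<Pi>\<^sub>M n\<in>{0..<m}. count_space UNIV)" for m
  proof -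
    have "{restrict x {0..<m}} = (\<Pi>\<^sub>E k\<in>{0..<m}. {x k})"
      by (auto simp: PiE_iff extensional_def fun_eq_iff)
    then show ?thesis
      by (metis (no_types, lifting) UNIV_I finite_atLeastLessThan sets_PiM_I_finite sets_count_space Pow_UNIV)
  qed
  have step: "emeasure (walk.eP V m y) {restrict x {0..<Suc m}} =
      emeasure (walk_step V m y) {x m} * indicator {restrict x {0..<m}} y"
    if y: "y \<in> space (\<Pi>\<^sub>M n\<in>{0..<m}. count_space UNIV)" for m y
  proof -
    have "(\<lambda>z. y(m := z)) -` {restrict x {0..<Suc m}} \<inter> space (count_space UNIV) =
        (if y = restrict x {0..<m} then {x m} else {})"
    proof -
      have "y(m := z) = restrict x {0..<Suc m} \<longleftrightarrow> y = restrict x {0..<m} \<and> z = x m" for z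
        using y by (auto simp: fun_eq_iff space_PiM PiE_iff extensional_def restrict_def less_Suc_eq)
      then show ?thesis by auto
    qed
    then show ?thesis
      by (subst walk.emeasure_eP[OF y meas]) auto
  qed
  {
    case 0
    have "walk.C V 0 (Suc 0) ?u = walk.eP V 0 ?u"
      unfolding walk.C.simps add_0_left by (rule bind_return[OF walk.measurable_eP]) (simp add: space_PiM)
    moreover have "emeasure (walk.eP V 0 ?u) {restrict x {0..<Suc 0}} = ennreal (indicator {0} (x 0))"
      by (subst step) (auto simp: space_PiM walk_step_def indicator_def)
    ultimately show ?case
      by (simp only: lessThan_0 prod.empty mult_1_right)
  next
    case (Suc n)
    have C: "space (walk.C V 0 (Suc n) ?u) = space (\<Pi>\<^sub>M n\<in>{0..<Suc n}. count_space UNIV)"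
        "sets (walk.C V 0 (Suc n) ?u) = sets (\<Pi>\<^sub>M n\<in>{0..<Suc n}. count_space UNIV)"
      using walk.space_C[of ?u 0 V "Suc n"] walk.sets_C[of ?u 0 V "Suc n"]
      by (simp_all add: space_PiM del: walk.C.simps)
    have "walk.C V 0 (Suc (Suc n)) ?u = walk.C V 0 (Suc n) ?u \<bind> walk.eP V (Suc n)"
      by (subst walk.C.simps(2)) simp
    then have "emeasure (walk.C V 0 (Suc (Suc n)) ?u) {restrict x {0..<Suc (Suc n)}} =
        (\<integral>\<^sup>+y. emeasure (walk.eP V (Suc n) y) {restrict x {0..<Suc (Suc n)}} \<partial>walk.C V 0 (Suc n) ?u)"
      apply (simp only:)
      apply (rule emeasure_bind[OF _ _ meas])
      subgoal by (simp add: C space_PiM PiE_eq_empty_iff del: walk.C.simps)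
      subgoal using walk.measurable_eP[of V "Suc n"] measurable_cong_sets[OF C(2) refl] by blast
      done
    also have "\<dots> = (\<integral>\<^sup>+y. ennreal (pmf (walk_kernel V (x n)) (x (Suc n))) * indicator {restrict x {0..<Suc n}} y
        \<partial>walk.C V 0 (Suc n) ?u)"
      by (intro nn_integral_cong)
         (auto simp: C step walk_step_def emeasure_pmf_single indicator_def simp del: walk.C.simps)
    also have "\<dots> = ennreal (pmf (walk_kernel V (x n)) (x (Suc n))) *
        emeasure (walk.C V 0 (Suc n) ?u) {restrict x {0..<Suc n}}"
      using meas[of "Suc n"] by (intro nn_integral_cmult_indicator) (simp only: C)
    finally show ?case
      unfolding Suc by (simp add: ennreal_mult' [symmetric] mult_ac del: walk.C.simps restrict_apply)
  }
qed

text \<open>The finite-dimensional distributions are those of the Markov chain started at 0.\<close>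

lemma emeasure_walk_law_cylinder:
  "emeasure (walk_law V) {X. \<forall>k\<le>n. X k = x k} =
     ennreal (indicator {0} (x 0) * (\<Prod>k<n. pmf (walk_kernel V (x k)) (x (Suc k))))"
proof -
  have "{restrict x {0..<Suc n}} = (\<Pi>\<^sub>E k\<in>{0..<Suc n}. {x k})"
    by (auto simp: PiE_iff extensional_def fun_eq_iff)
  then have m: "{restrict x {0..<Suc n}} \<in> sets (\<Pi>\<^sub>M n\<in>{0..<Suc n}. count_space UNIV)"
    by (metis (no_types, lifting) UNIV_I finite_atLeastLessThan sets_PiM_I_finite sets_count_space Pow_UNIV)
  have "{X. \<forall>k\<le>n. X k = x k} = walk.PF.emb UNIV {0..<Suc n} {restrict x {0..<Suc n}}"
    by (auto simp: prod_emb_def space_PiM fun_eq_iff restrict_def less_Suc_eq_le split: if_splits)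
  then have "emeasure (walk_law V) {X. \<forall>k\<le>n. X k = x k} = emeasure (walk.CI V {0..<Suc n}) {restrict x {0..<Suc n}}"
    unfolding walk_law_def using m by (simp only: walk.lim finite_atLeastLessThan)
  also have "\<dots> = emeasure (walk.C V 0 (Suc n) (\<lambda>_. undefined)) {restrict x {0..<Suc n}}"
    using m by (subst walk.emeasure_CI[of _ "Suc n"]) (auto simp: prod_emb_id space_PiM simp del: walk.C.simps)
  finally show ?thesis
    by (simp only: emeasure_walk_C)
qed

text \<open>The number of visits to 0, counted in $[0,\infty]$ (\<^const>\<open>card\<close> would give 0 for
  infinitely many visits).\<close>

definition visits_zero :: "(nat \<Rightarrow> int) \<Rightarrow> ennreal" where
  "visits_zero X = emeasure (count_space UNIV) {n. X n = 0}"

text \<open>The potential that vanishes at 0, is symmetric with respect to $-1/2$, and has the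
  increments \<open>d\<close> on the positive half-line.\<close>

definition symmetric_potential :: "(nat \<Rightarrow> real) \<Rightarrow> int \<Rightarrow> real" where
  "symmetric_potential d i = (\<Sum>j = 1..nat (if 0 \<le> i then i else - i - 1). d j)"

lemma symmetric_potential_0: "symmetric_potential d 0 = 0"
  by (simp add: symmetric_potential_def)

lemma symmetric_potential_symmetric:
  "0 \<le> i \<Longrightarrow> symmetric_potential d i = symmetric_potential d (- i - 1)"
  by (simp add: symmetric_potential_def)

lemma symmetric_potential_increment:
  assumes "1 \<le> i"
  shows "symmetric_potential d (int i) - symmetric_potential d (int i - 1) = d i"
proof -
  obtain k where "i = Suc k" using assms by (cases i) auto
  then have "nat (int i) = Suc k" "nat (int i - 1) = k"
    by simp_all
  then show ?thesis
    using \<open>i = Suc k\<close> by (simp add: symmetric_potential_def)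
qed

text \<open>Slow variation at infinity: \<open>L\<close> needs to be positive and measurable only on a
  neighbourhood of infinity.\<close>

definition slowly_varying :: "(real \<Rightarrow> real) \<Rightarrow> bool" where
  "slowly_varying L \<longleftrightarrow>
     (\<exists>a. (\<forall>x\<ge>a. 0 < L x) \<and> L \<in> borel_measurable (restrict_space borel {a..})) \<and>
     (\<forall>c>0. ((\<lambda>x. L (c * x) / L x) \<longlongrightarrow> 1) at_top)"

definition renewal_process ::
    "'a measure \<Rightarrow> (nat \<Rightarrow> 'a \<Rightarrow> nat) \<Rightarrow> real \<Rightarrow> (real \<Rightarrow> real) \<Rightarrow> bool" where
  "renewal_process M \<tau> \<alpha> L \<longleftrightarrow>
     (\<forall>x\<in>space M. \<tau> 0 x = 0 \<and> (\<forall>i. \<tau> i x < \<tau> (Suc i) x)) \<and>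
     prob_space.indep_vars M (\<lambda>_. count_space UNIV) (\<lambda>i x. \<tau> (Suc i) x - \<tau> i x) UNIV \<and>
     (\<forall>i. distr M (count_space UNIV) (\<lambda>x. \<tau> (Suc i) x - \<tau> i x) =
          distr M (count_space UNIV) (\<lambda>x. \<tau> 1 x - \<tau> 0 x)) \<and>
     (\<forall>n\<ge>1. measure M {x \<in> space M. \<tau> 1 x = n} = L (real n) * real n powr (- (1 + \<alpha>)))"

text \<open>Averaging over \<open>\<tau>\<close> with the disorder frozen is integration with respect to this law.\<close>

definition renewal_law :: "'a measure \<Rightarrow> (nat \<Rightarrow> 'a \<Rightarrow> nat) \<Rightarrow> (nat \<Rightarrow> nat) measure" where
  "renewal_law M \<tau> = distr M (\<Pi>\<^sub>M i\<in>UNIV. count_space UNIV) (\<lambda>x i. \<tau> i x)"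

definition iid_disorder :: "'a measure \<Rightarrow> (nat \<Rightarrow> 'a \<Rightarrow> real) \<Rightarrow> bool" where
  "iid_disorder M \<omega> \<longleftrightarrow>
     prob_space.indep_vars M (\<lambda>_. borel) \<omega> {1..} \<and>
     (\<forall>i\<ge>1. distr M borel (\<omega> i) = distr M borel (\<omega> 1)) \<and>
     integrable M (\<omega> 1) \<and> integral\<^sup>L M (\<omega> 1) = 0 \<and>
     (\<forall>b\<ge>0. integrable M (\<lambda>x. exp (b * \<omega> 1 x)))"

text \<open>This is independence of the generated sigma-algebras; \<^const>\<open>prob_space.indep_var\<close> requires both
  variables to have the same type of values.\<close>

definition independent_of_disorder ::
    "'a measure \<Rightarrow> (nat \<Rightarrow> 'a \<Rightarrow> nat) \<Rightarrow> (nat \<Rightarrow> 'a \<Rightarrow> real) \<Rightarrow> bool" where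
  "independent_of_disorder M \<tau> \<omega> \<longleftrightarrow>
     prob_space.indep_set M
       (sets (vimage_algebra (space M) (\<lambda>x i. \<tau> i x) (\<Pi>\<^sub>M i\<in>UNIV. count_space UNIV)))
       (sets (vimage_algebra (space M) (\<lambda>x. \<lambda>i\<in>{1..}. \<omega> i x) (\<Pi>\<^sub>M i\<in>{1..}. borel)))"

text \<open>Here \<open>w\<close> and \<open>S\<close> are realisations of the disorder and of the set of renewal points.\<close>

definition sparse_potential :: "real \<Rightarrow> real \<Rightarrow> real \<Rightarrow> (nat \<Rightarrow> real) \<Rightarrow> nat set \<Rightarrow> int \<Rightarrow> real" where
  "sparse_potential \<beta> h f w S =
     symmetric_potential (\<lambda>i. (h + \<beta> * w i) * indicator S i - f)"

definition sparse_walk_law ::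
    "real \<Rightarrow> real \<Rightarrow> real \<Rightarrow> (nat \<Rightarrow> real) \<Rightarrow> nat set \<Rightarrow> (nat \<Rightarrow> int) measure" where
  "sparse_walk_law \<beta> h f w S = walk_law (sparse_potential \<beta> h f w S)"

text \<open>\<open>P\<close> is the law of the renewal process on sequences.\<close>

definition pinning_Z ::
    "(nat \<Rightarrow> nat) measure \<Rightarrow> real \<Rightarrow> real \<Rightarrow> (nat \<Rightarrow> real) \<Rightarrow> nat \<Rightarrow> real" where
  "pinning_Z P \<beta> h w n =
     (if n = 0 then 1
      else (\<integral>t. exp (\<Sum>i = 1..n. (\<beta> * w i + h) * indicator (range t) i) \<partial>P))"

definition grand_canonical_Z ::
    "(nat \<Rightarrow> nat) measure \<Rightarrow> real \<Rightarrow> real \<Rightarrow> (nat \<Rightarrow> real) \<Rightarrow> real \<Rightarrow> ennreal" where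
  "grand_canonical_Z P \<beta> h w f = (\<Sum>n. ennreal (pinning_Z P \<beta> h w n * exp (- f * real n)))"

end

theory Submission
  imports Defs
begin

text \<open>
  The walk in potential \<open>V\<close> is the random walk on the electrical network on \<open>\<int>\<close> in which the edge
  between \<open>i\<close> and \<open>i + 1\<close> has resistance \<open>exp (V i)\<close>. The expected number of visits to 0 is the total
  conductance at 0 times the effective resistance from 0 to infinity. Since
  \<open>V 0 = V (- 1) = 0\<close>, that conductance is 2. By the symmetry of \<open>V\<close>, the two half-lines are in
  parallel with the same resistance \<open>\<Sum>n. exp (V n)\<close>, so the effective resistance is half of
  this sum. Hence the expected number of visits is exactly \<open>\<Sum>n. exp (V n)\<close>
  (\<open>expected_visits_zero\<close>), for every realisation of the environment and with both sides
  possibly infinite.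

  This is proved without network theory. Write \<open>P\<close> for the transition operator of the walk. The
  resistance \<open>u i = (\<Sum>n \<ge> \<bar>i\<bar>. exp (V n))\<close> between
  \<open>i\<close> and the end of its half-line solves \<open>P u = u\<close> away from 0 and \<open>P u = u - 1\<close> at 0
  (\<open>resistance_Poisson_equation\<close>). Therefore \<open>u 0\<close> equals the expected number of visits to 0
  before time \<open>m\<close> plus the expectation of \<open>u (X m)\<close>. Dropping the last term gives one
  inequality. For the other one, \<open>u\<close> is replaced by the resistance \<open>u\<^sub>N\<close> to the points at distance
  \<open>N\<close>: it has bounded support, so the expectation of \<open>u\<^sub>N (X m)\<close> vanishes as
  \<open>m \<rightarrow> \<infinity>\<close> unless the expected number of visits is infinite
  (\<open>walk_pmf_tendsto_0\<close>).

  For the sparse potential, \<open>exp (V n)\<close> is the Boltzmann weight of the pinning model of length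
  \<open>n\<close> times \<open>exp (- f n)\<close>. Averaging over the renewal process term by term, by Tonelli, yields
  the grand canonical partition function.
\<close>

section \<open>One-dimensional marginals of the walk\<close>

primrec walk_pmf :: "(int \<Rightarrow> real) \<Rightarrow> nat \<Rightarrow> int pmf" where
  "walk_pmf V 0 = return_pmf 0"
| "walk_pmf V (Suc n) = bind_pmf (walk_pmf V n) (walk_kernel V)"

text \<open>The trajectory up to time \<open>n\<close> is built by successive kernel extensions; projecting each
  extension to its last coordinate turns it into one \<open>bind_pmf\<close> with \<open>walk_kernel\<close>.\<close>

lemma distr_walk_C:
  "distr (walk.C V 0 (Suc n) (\<lambda>_. undefined)) (count_space UNIV) (\<lambda>x. x n) = measure_pmf (walk_pmf V n)"
proof (induction n)
  let ?u = "\<lambda>_::nat. undefined :: int"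
  have comp: "(\<lambda>x. x m) \<in> measurable (\<Pi>\<^sub>M n\<in>{0..<Suc m}. count_space UNIV) (count_space (UNIV :: int set))" for m
    by (intro measurable_component_singleton) simp
  have sets_C: "sets (walk.C V 0 m ?u) = sets (\<Pi>\<^sub>M n\<in>{0..<m}. count_space UNIV)" for m
    using walk.sets_C[of ?u 0 V m] by (simp add: space_PiM del: walk.C.simps)
  then have space_C: "space (walk.C V 0 m ?u) = space (\<Pi>\<^sub>M n\<in>{0..<m}. count_space UNIV)" for m
    by (rule sets_eq_imp_space_eq)
  have comp_C: "(\<lambda>x. x m) \<in> measurable (walk.C V 0 (Suc m) ?u) (count_space UNIV)" for m
    using comp[of m] measurable_cong_sets[OF sets_C refl] by blast
  have last: "emeasure (distr (walk.C V 0 (Suc m) ?u) (count_space UNIV) (\<lambda>x. x m)) {j} =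
      (\<integral>\<^sup>+y. emeasure (walk_step V m y) {j} \<partial>walk.C V 0 m ?u)" for m j
  proof -
    let ?A = "(\<lambda>x. x m) -` {j} \<inter> space (\<Pi>\<^sub>M n\<in>{0..<Suc m}. count_space (UNIV :: int set))"
    have A: "?A \<in> sets (\<Pi>\<^sub>M n\<in>{0..<Suc m}. count_space UNIV)"
      by (rule measurable_sets[OF comp]) simp
    have C: "walk.C V 0 (Suc m) ?u = walk.C V 0 m ?u \<bind> walk.eP V m"
      by (subst walk.C.simps(2)) simp
    have "emeasure (distr (walk.C V 0 (Suc m) ?u) (count_space UNIV) (\<lambda>x. x m)) {j} =
        emeasure (walk.C V 0 (Suc m) ?u) ?A"
      unfolding space_C[symmetric] by (rule emeasure_distr[OF comp_C]) simp
    also have "\<dots> = emeasure (walk.C V 0 m ?u \<bind> walk.eP V m) ?A"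
      by (simp only: C)
    also have "\<dots> = (\<integral>\<^sup>+y. emeasure (walk.eP V m y) ?A \<partial>walk.C V 0 m ?u)"
      apply (rule emeasure_bind[OF _ _ A])
      subgoal by (simp add: space_C space_PiM PiE_eq_empty_iff del: walk.C.simps)
      subgoal using walk.measurable_eP[of V m] measurable_cong_sets[OF sets_C refl] by blast
      done
    also have "\<dots> = (\<integral>\<^sup>+y. emeasure (walk_step V m y) {j} \<partial>walk.C V 0 m ?u)"
    proof (rule nn_integral_cong)
      fix y assume "y \<in> space (walk.C V 0 m ?u)"
      then have y: "y \<in> space (\<Pi>\<^sub>M n\<in>{0..<m}. count_space UNIV)" by (simp only: space_C)
      then have "(\<lambda>z. y(m := z)) -` ?A \<inter> space (count_space UNIV) = {j}"
        by (auto simp: space_PiM PiE_iff extensional_def)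
      then show "emeasure (walk.eP V m y) ?A = emeasure (walk_step V m y) {j}"
        by (subst walk.emeasure_eP[OF y A]) simp
    qed
    finally show ?thesis .
  qed
  {
    case 0
    have "emeasure (distr (walk.C V 0 (Suc 0) ?u) (count_space UNIV) (\<lambda>x. x 0)) {j} =
        emeasure (walk_pmf V 0) {j}" for j
      unfolding last walk.C.simps(1)
      by (subst nn_integral_return) (simp_all add: space_PiM walk_step_def measurable_count_space_eq1)
    then show ?case
      by (intro measure_eqI_countable[where A=UNIV]) (simp_all del: walk.C.simps)
  next
    case (Suc n)
    show ?case
    proof (rule measure_eqI_countable[where A=UNIV])
      fix j :: int
      have "emeasure (distr (walk.C V 0 (Suc (Suc n)) ?u) (count_space UNIV) (\<lambda>x. x (Suc n))) {j} =
          (\<integral>\<^sup>+y. ennreal (pmf (walk_kernel V (y n)) j) \<partial>walk.C V 0 (Suc n) ?u)"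
        by (simp only: last) (simp add: walk_step_def emeasure_pmf_single del: walk.C.simps)
      also have "\<dots> = (\<integral>\<^sup>+i. ennreal (pmf (walk_kernel V i) j) \<partial>distr (walk.C V 0 (Suc n) ?u) (count_space UNIV) (\<lambda>x. x n))"
        by (rule nn_integral_distr[OF comp_C, symmetric]) simp
      also have "\<dots> = emeasure (walk_pmf V (Suc n)) {j}"
        by (simp only: Suc.IH) (simp add: emeasure_pmf_single ennreal_pmf_bind)
      finally show "emeasure (distr (walk.C V 0 (Suc (Suc n)) ?u) (count_space UNIV) (\<lambda>x. x (Suc n))) {j} =
          emeasure (walk_pmf V (Suc n)) {j}" .
    qed (simp_all del: walk.C.simps)
  }
qed

lemma measurable_walk_law_coordinate [measurable]:
  "(\<lambda>X. X n) \<in> measurable (walk_law V) (count_space UNIV)"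
  by measurable

lemma emeasure_walk_law_coordinate:
  "emeasure (walk_law V) {X. X n = i} = ennreal (pmf (walk_pmf V n) i)"
proof -
  let ?u = "\<lambda>_::nat. undefined :: int"
  let ?P = "\<Pi>\<^sub>M n\<in>{0..<Suc n}. count_space (UNIV :: int set)"
  let ?A = "(\<lambda>x. x n) -` {i} \<inter> space ?P"
  have comp: "(\<lambda>x. x n) \<in> measurable ?P (count_space UNIV)"
    by (intro measurable_component_singleton) simp
  then have A: "?A \<in> sets ?P"
    by (rule measurable_sets) simp
  have sets_C: "sets (walk.C V 0 (Suc n) ?u) = sets ?P"
    using walk.sets_C[of ?u 0 V "Suc n"] by (simp add: space_PiM del: walk.C.simps)
  then have space_C: "space (walk.C V 0 (Suc n) ?u) = space ?P"
    by (rule sets_eq_imp_space_eq)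
  have comp_C: "(\<lambda>x. x n) \<in> measurable (walk.C V 0 (Suc n) ?u) (count_space UNIV)"
    using comp measurable_cong_sets[OF sets_C refl] by blast
  have "{X. X n = i} = walk.PF.emb UNIV {0..<Suc n} ?A"
    by (auto simp: prod_emb_def space_PiM PiE_iff restrict_def)
  then have "emeasure (walk_law V) {X. X n = i} = emeasure (walk.CI V {0..<Suc n}) ?A"
    unfolding walk_law_def using A by (simp only: walk.lim finite_atLeastLessThan)
  also have "\<dots> = emeasure (walk.C V 0 (Suc n) ?u) ?A"
    using A by (subst walk.emeasure_CI[of _ "Suc n"]) (auto simp: prod_emb_id space_PiM simp del: walk.C.simps)
  also have "\<dots> = emeasure (distr (walk.C V 0 (Suc n) ?u) (count_space UNIV) (\<lambda>x. x n)) {i}"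
    unfolding space_C[symmetric] by (rule emeasure_distr[OF comp_C, symmetric]) simp
  finally show ?thesis
    by (simp only: distr_walk_C emeasure_pmf_single)
qed

lemma nn_integral_visits_zero:
  "(\<integral>\<^sup>+X. visits_zero X \<partial>walk_law V) = (\<Sum>n. ennreal (pmf (walk_pmf V n) 0))"
proof -
  have "visits_zero X = (\<Sum>n. indicator {X. X n = 0} X)" for X
  proof -
    have "visits_zero X = (\<integral>\<^sup>+n. indicator {n. X n = 0} n \<partial>count_space UNIV)"
      unfolding visits_zero_def by (subst nn_integral_indicator) auto
    then show ?thesis
      by (simp add: nn_integral_count_space_nat indicator_def)
  qed
  moreover have sets: "{X. X n = 0} \<in> sets (walk_law V)" for n
  proof -
    have "{X. X n = 0} = (\<lambda>X. X n) -` {0} \<inter> space (walk_law V)"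
      by (auto simp: space_walk_law)
    then show ?thesis
      using measurable_sets[OF measurable_walk_law_coordinate, of "{0}" n V] by simp
  qed
  ultimately show ?thesis
    by (simp add: nn_integral_suminf emeasure_walk_law_coordinate)
qed


section \<open>Potential theory of the walk\<close>

lemma walk_prob_bounds: "0 < walk_prob V i" "walk_prob V i < 1"
  by (auto simp: walk_prob_def add_pos_pos divide_simps)

text \<open>The non-negative function \<open>g\<close> is real-valued so that the value on the right can be computed
  by field arithmetic, which is not available in \<open>ennreal\<close>.\<close>

lemma nn_integral_walk_kernel:
  assumes "\<And>i. 0 \<le> g i"
  shows "(\<integral>\<^sup>+j. ennreal (g j) \<partial>walk_kernel V i) =
    ennreal (walk_prob V i * g (i + 1) + (1 - walk_prob V i) * g (i - 1))"
  using walk_prob_bounds[of V i] assms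
  by (simp add: walk_kernel_def nn_integral_map_pmf less_imp_le ennreal_mult' mult_ac)

text \<open>If \<open>u\<close> decreases on average by at most 1 in a step from 0 and by nothing in a step from
  elsewhere, then the total decrease up to time \<open>m\<close> is at most the expected number of visits to 0
  before \<open>m\<close>. Both sides are arranged as sums, so that no subtraction in \<open>ennreal\<close> occurs.\<close>

lemma expected_visits_lower_bound:
  assumes "\<And>i. u i \<le> (\<integral>\<^sup>+j. u j \<partial>walk_kernel V i) + indicator {0} i"
  shows "u 0 \<le> (\<Sum>n<m. ennreal (pmf (walk_pmf V n) 0)) + (\<integral>\<^sup>+i. u i \<partial>walk_pmf V m)"
proof (induction m)
  case 0
  show ?case by (simp add: nn_integral_return)
next
  case (Suc m)
  have "(\<integral>\<^sup>+i. u i \<partial>walk_pmf V m) \<le> (\<integral>\<^sup>+i. (\<integral>\<^sup>+j. u j \<partial>walk_kernel V i) + indicator {0} i \<partial>walk_pmf V m)"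
    by (intro nn_integral_mono assms)
  also have "\<dots> = (\<integral>\<^sup>+i. u i \<partial>walk_pmf V (Suc m)) + ennreal (pmf (walk_pmf V m) 0)"
    by (simp add: nn_integral_add emeasure_pmf_single)
  finally have "(\<Sum>n<m. ennreal (pmf (walk_pmf V n) 0)) + (\<integral>\<^sup>+i. u i \<partial>walk_pmf V m) \<le>
      (\<Sum>n<m. ennreal (pmf (walk_pmf V n) 0)) +
      ((\<integral>\<^sup>+i. u i \<partial>walk_pmf V (Suc m)) + ennreal (pmf (walk_pmf V m) 0))"
    by (rule add_left_mono)
  note order_trans[OF Suc.IH this]
  also have "(\<Sum>n<m. ennreal (pmf (walk_pmf V n) 0)) +
      ((\<integral>\<^sup>+i. u i \<partial>walk_pmf V (Suc m)) + ennreal (pmf (walk_pmf V m) 0)) =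
      (\<Sum>n<Suc m. ennreal (pmf (walk_pmf V n) 0)) + (\<integral>\<^sup>+i. u i \<partial>walk_pmf V (Suc m))"
    by (simp only: sum.lessThan_Suc add.assoc add.commute[of "nn_integral _ _"])
  finally show ?case .
qed

lemma expected_visits_upper_bound:
  assumes "\<And>i. (\<integral>\<^sup>+j. u j \<partial>walk_kernel V i) + indicator {0} i \<le> u i"
  shows "(\<Sum>n<m. ennreal (pmf (walk_pmf V n) 0)) + (\<integral>\<^sup>+i. u i \<partial>walk_pmf V m) \<le> u 0"
proof (induction m)
  case 0
  show ?case by (simp add: nn_integral_return)
next
  case (Suc m)
  have "(\<integral>\<^sup>+i. u i \<partial>walk_pmf V (Suc m)) + ennreal (pmf (walk_pmf V m) 0) =
      (\<integral>\<^sup>+i. (\<integral>\<^sup>+j. u j \<partial>walk_kernel V i) + indicator {0} i \<partial>walk_pmf V m)"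
    by (simp add: nn_integral_add emeasure_pmf_single)
  also have "\<dots> \<le> (\<integral>\<^sup>+i. u i \<partial>walk_pmf V m)"
    by (intro nn_integral_mono assms)
  finally have "(\<Sum>n<m. ennreal (pmf (walk_pmf V n) 0)) +
      ((\<integral>\<^sup>+i. u i \<partial>walk_pmf V (Suc m)) + ennreal (pmf (walk_pmf V m) 0)) \<le>
      (\<Sum>n<m. ennreal (pmf (walk_pmf V n) 0)) + (\<integral>\<^sup>+i. u i \<partial>walk_pmf V m)"
    by (rule add_left_mono)
  note order_trans[OF this Suc.IH]
  moreover have "(\<Sum>n<m. ennreal (pmf (walk_pmf V n) 0)) +
      ((\<integral>\<^sup>+i. u i \<partial>walk_pmf V (Suc m)) + ennreal (pmf (walk_pmf V m) 0)) =
      (\<Sum>n<Suc m. ennreal (pmf (walk_pmf V n) 0)) + (\<integral>\<^sup>+i. u i \<partial>walk_pmf V (Suc m))"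
    by (simp only: sum.lessThan_Suc add.assoc add.commute[of "nn_integral _ _"])
  ultimately show ?case by (simp only:)
qed

text \<open>One of the ways to be at \<open>j\<close> at time \<open>n + 1\<close> is to arrive there from \<open>i\<close>.\<close>

lemma pmf_walk_pmf_step:
  "pmf (walk_pmf V n) i * pmf (walk_kernel V i) j \<le> pmf (walk_pmf V (Suc n)) j"
proof -
  have "ennreal (pmf (walk_pmf V n) i * pmf (walk_kernel V i) j) =
      (\<integral>\<^sup>+k. ennreal (pmf (walk_kernel V i) j) * indicator {i} k \<partial>walk_pmf V n)"
    by (subst nn_integral_cmult_indicator) (simp_all add: emeasure_pmf_single ennreal_mult' mult.commute)
  also have "\<dots> \<le> (\<integral>\<^sup>+k. ennreal (pmf (walk_kernel V k) j) \<partial>walk_pmf V n)"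
    by (intro nn_integral_mono) (auto simp: indicator_def)
  finally show ?thesis
    by (simp add: ennreal_pmf_bind[symmetric])
qed

text \<open>Both nearest-neighbour steps have positive probability, so a fixed fraction of the mass at a site is
  at each neighbour one step later. Decay at 0 thus propagates from site to site.\<close>

lemma walk_pmf_tendsto_0:
  assumes "(\<lambda>n. pmf (walk_pmf V n) 0) \<longlonglongrightarrow> 0"
  shows "(\<lambda>n. pmf (walk_pmf V n) i) \<longlonglongrightarrow> 0"
proof (induction i rule: int_induct[where k = 0])
  have neighbour: "(\<lambda>n. pmf (walk_pmf V n) i) \<longlonglongrightarrow> 0"
    if lim: "(\<lambda>n. pmf (walk_pmf V n) j) \<longlonglongrightarrow> 0" and pos: "0 < pmf (walk_kernel V i) j" for i j
  proof (rule tendsto_sandwich[OF _ _ tendsto_const])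
    show "\<forall>\<^sub>F n in sequentially. pmf (walk_pmf V n) i \<le> pmf (walk_pmf V (Suc n)) j / pmf (walk_kernel V i) j"
      using pmf_walk_pmf_step[of V _ i j] pos by (simp add: pos_le_divide_eq)
    show "(\<lambda>n. pmf (walk_pmf V (Suc n)) j / pmf (walk_kernel V i) j) \<longlonglongrightarrow> 0"
      using tendsto_divide[OF LIMSEQ_Suc[OF lim] tendsto_const, of "pmf (walk_kernel V i) j"] pos by simp
  qed simp
  {
    case base
    show ?case by (fact assms)
  next
    case (step1 i)
    show ?case
      using neighbour[OF step1(2), of "i + 1"] walk_prob_bounds[of V "i + 1"] by (simp add: pmf_walk_kernel)
  next
    case (step2 i)
    show ?case
      using neighbour[OF step2(2), of "i - 1"] walk_prob_bounds[of V "i - 1"] by (simp add: pmf_walk_kernel)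
  }
qed

text \<open>By the reflection symmetry of \<open>V\<close> about \<open>-1/2\<close>, the absolute value of the walk is itself a
  nearest-neighbour walk, reflected at 0. It moves outwards from \<open>k + 1\<close> with probability
  proportional to the conductance \<open>exp (- V (k + 1))\<close> of the outer edge and inwards with
  probability proportional to \<open>exp (- V k)\<close>; the fraction below is the resulting mean after
  clearing the negative exponents.\<close>

lemma walk_kernel_radial:
  assumes sym: "\<And>i. 0 \<le> i \<Longrightarrow> V i = V (- i - 1)"
    and "\<And>k. 0 \<le> g k"
  shows "(\<integral>\<^sup>+j. ennreal (g (nat \<bar>j\<bar>)) \<partial>walk_kernel V 0) = ennreal (g 1)"
    and "i \<noteq> 0 \<Longrightarrow> nat \<bar>i\<bar> = Suc k \<Longrightarrow> (\<integral>\<^sup>+j. ennreal (g (nat \<bar>j\<bar>)) \<partial>walk_kernel V i) =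
      ennreal ((exp (V k) * g (k + 2) + exp (V (k + 1)) * g k) / (exp (V k) + exp (V (k + 1))))"
proof -
  show "(\<integral>\<^sup>+j. ennreal (g (nat \<bar>j\<bar>)) \<partial>walk_kernel V 0) = ennreal (g 1)"
    using sym[of 0] assms(2) by (subst nn_integral_walk_kernel) (auto simp: walk_prob_def)
next
  assume "i \<noteq> 0" and k: "nat \<bar>i\<bar> = Suc k"
  define a b where "a = exp (V (int k))" and "b = exp (V (int k + 1))"
  have pos: "0 < a" "0 < b" by (simp_all add: a_def b_def)
  consider "i = int k + 1" | "i = - int k - 1"
    using k by linarith
  then have "walk_prob V i * g (nat \<bar>i + 1\<bar>) + (1 - walk_prob V i) * g (nat \<bar>i - 1\<bar>) =
      (a * g (k + 2) + b * g k) / (a + b)"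
  proof cases
    case 1
    have "walk_prob V i = a / (a + b)"
      unfolding walk_prob_def 1 exp_diff add_diff_cancel_right' a_def[symmetric] b_def[symmetric]
      using pos by (simp add: field_simps)
    moreover have "nat \<bar>i + 1\<bar> = k + 2" "nat \<bar>i - 1\<bar> = k" using 1 by simp_all
    moreover have "1 - a / (a + b) = b / (a + b)"
      using pos by (simp add: field_simps)
    ultimately show ?thesis by (simp only:) (simp add: add_divide_distrib)
  next
    case 2
    have V: "V i = V (int k)" "V (i - 1) = V (int k + 1)"
      unfolding 2 using sym[of "int k"] sym[of "int k + 1"] by simp_all
    have "walk_prob V i = b / (a + b)"
      unfolding walk_prob_def V exp_diff a_def[symmetric] b_def[symmetric]
      using pos by (simp add: field_simps)
    moreover have "nat \<bar>i + 1\<bar> = k" "nat \<bar>i - 1\<bar> = k + 2" using 2 by simp_all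
    moreover have "1 - b / (a + b) = a / (a + b)"
      using pos by (simp add: field_simps)
    ultimately show ?thesis by (simp only:) (simp add: add_divide_distrib)
  qed
  then show "(\<integral>\<^sup>+j. ennreal (g (nat \<bar>j\<bar>)) \<partial>walk_kernel V i) =
      ennreal ((exp (V k) * g (k + 2) + exp (V (k + 1)) * g k) / (exp (V k) + exp (V (k + 1))))"
    using assms(2) by (subst nn_integral_walk_kernel) (auto simp: a_def b_def add.commute)
qed

text \<open>Here \<open>g k\<close> is the resistance between \<open>k\<close> and the boundary, prescribed only through its
  increments below level \<open>n\<close>; this covers both a boundary at distance \<open>n\<close> and a boundary at
  infinity. At a site other than 0, Kirchhoff's law holds because the outer increment \<open>exp (V k)\<close>
  times the outer conductance \<open>exp (- V k)\<close> equals the same product for the inner edge. At 0 the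
  walk moves to level 1 in either case, and \<open>g 1 = g 0 - 1\<close>.\<close>

lemma resistance_Poisson_equation:
  assumes sym: "\<And>i. 0 \<le> i \<Longrightarrow> V i = V (- i - 1)" and "V 0 = 0"
    and nonneg: "\<And>k. 0 \<le> g k"
    and step: "\<And>k. k < n \<Longrightarrow> g k = exp (V (int k)) + g (Suc k)"
    and i: "\<bar>i\<bar> < int n"
  shows "(\<integral>\<^sup>+j. ennreal (g (nat \<bar>j\<bar>)) \<partial>walk_kernel V i) + indicator {0} i = ennreal (g (nat \<bar>i\<bar>))"
proof (cases "i = 0")
  case True
  have "g 0 = 1 + g 1" using step[of 0] i assms(2) by simp
  then show ?thesis
    using nonneg[of 1] True by (simp add: walk_kernel_radial(1)[where V=V and g=g, OF sym nonneg] add.commute flip: ennreal_1 ennreal_plus del: ennreal_1)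
next
  case False
  then obtain k where k: "nat \<bar>i\<bar> = Suc k" by (cases "nat \<bar>i\<bar>") auto
  define a b where "a = exp (V (int k))" and "b = exp (V (int k + 1))"
  have pos: "0 < a" "0 < b" by (simp_all add: a_def b_def)
  have "g k = a + g (Suc k)" "g (Suc k) = b + g (k + 2)"
    using step[of k] step[of "Suc k"] k i by (simp_all add: a_def b_def algebra_simps)
  then have "a * g (k + 2) + b * g k = g (Suc k) * (a + b)"
    by (simp add: algebra_simps)
  then have "(a * g (k + 2) + b * g k) / (a + b) = g (Suc k)"
    using pos by simp
  then show ?thesis
    using False k walk_kernel_radial(2)[where V=V and g=g, OF sym nonneg False k] by (simp add: a_def b_def add.commute)
qed

text \<open>In each inequality the right-hand side may be assumed finite. For \<open>\<le>\<close> this makes the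
  resistance to infinity a finite solution of the Poisson equation. For \<open>\<ge>\<close> it makes the
  return probabilities summable, so that the walk leaves every bounded set.\<close>

lemma expected_visits_zero:
  assumes sym: "\<And>i. 0 \<le> i \<Longrightarrow> V i = V (- i - 1)" and V0: "V 0 = 0"
  shows "(\<integral>\<^sup>+X. visits_zero X \<partial>walk_law V) = (\<Sum>n. ennreal (exp (V (int n))))"
  unfolding nn_integral_visits_zero
proof (rule antisym)
  let ?G = "\<Sum>n. ennreal (pmf (walk_pmf V n) 0)"
  show "?G \<le> (\<Sum>n. ennreal (exp (V (int n))))"
  proof (cases "(\<Sum>n. ennreal (exp (V (int n)))) = \<top>")
    case False
    then have sum: "summable (\<lambda>n. exp (V (int n)))"
      by (intro summable_suminf_not_top) auto
    \<comment> \<open>the resistance between level \<open>k\<close> and infinity\<close>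
    define g where "g k = (\<Sum>n. exp (V (int (n + k))))" for k
    have sum': "summable (\<lambda>n. exp (V (int (n + k))))" for k
      using summable_ignore_initial_segment[OF sum] .
    have nonneg: "0 \<le> g k" for k
      unfolding g_def by (intro suminf_nonneg sum') simp
    have step: "g k = exp (V (int k)) + g (Suc k)" for k
      using suminf_split_head[OF sum'[of k]] by (simp add: g_def)
    have "(\<integral>\<^sup>+j. ennreal (g (nat \<bar>j\<bar>)) \<partial>walk_kernel V i) + indicator {0} i \<le> ennreal (g (nat \<bar>i\<bar>))" for i
      using resistance_Poisson_equation[where n="Suc (nat \<bar>i\<bar>)", OF sym V0 nonneg step] by simp
    then have "(\<Sum>n<m. ennreal (pmf (walk_pmf V n) 0)) + (\<integral>\<^sup>+i. ennreal (g (nat \<bar>i\<bar>)) \<partial>walk_pmf V m) \<le> ennreal (g 0)" for m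
      using expected_visits_upper_bound[where u="\<lambda>i. ennreal (g (nat \<bar>i\<bar>))" and V=V and m=m] by simp
    then have "(\<Sum>n<m. ennreal (pmf (walk_pmf V n) 0)) \<le> ennreal (g 0)" for m
      by (rule order_trans[OF add_increasing2[OF zero_le order_refl]])
    then have "?G \<le> ennreal (g 0)"
      by (intro suminf_le_const) auto
    also have "\<dots> = (\<Sum>n. ennreal (exp (V (int n))))"
      unfolding g_def by (subst suminf_ennreal2) (use sum in auto)
    finally show ?thesis .
  qed simp
  show "(\<Sum>n. ennreal (exp (V (int n)))) \<le> ?G"
  proof (cases "?G = \<top>")
    case False
    then have "summable (\<lambda>n. pmf (walk_pmf V n) 0)"
      by (intro summable_suminf_not_top) auto
    then have lim: "(\<lambda>n. pmf (walk_pmf V n) i) \<longlonglongrightarrow> 0" for i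
      by (rule walk_pmf_tendsto_0[OF summable_LIMSEQ_zero])
    have "(\<Sum>n<N. ennreal (exp (V (int n)))) \<le> ?G" for N
    proof -
      \<comment> \<open>the resistance between level \<open>k\<close> and level \<open>N\<close>, which is 0 beyond \<open>N\<close>; there it is
        only subharmonic, which suffices for the lower bound\<close>
      define g where "g k = (\<Sum>n=k..<N. exp (V (int n)))" for k
      have nonneg: "0 \<le> g k" for k
        unfolding g_def by (intro sum_nonneg) simp
      have step: "g k = exp (V (int k)) + g (Suc k)" if "k < N" for k
        unfolding g_def using that by (simp add: sum.atLeast_Suc_lessThan)
      have zero: "g k = 0" if "N \<le> k" for k
        unfolding g_def using that by simp
      have le: "g k \<le> g 0" for k
        unfolding g_def by (intro sum_mono2) auto
      have sub: "ennreal (g (nat \<bar>i\<bar>)) \<le> (\<integral>\<^sup>+j. ennreal (g (nat \<bar>j\<bar>)) \<partial>walk_kernel V i) + indicator {0} i" for i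
      proof (cases "\<bar>i\<bar> < int N")
        case True
        then show ?thesis
          using resistance_Poisson_equation[where n=N and i=i and g=g, OF sym V0 nonneg step] by simp
      next
        case False
        then show ?thesis using zero[of "nat \<bar>i\<bar>"] by simp
      qed
      let ?B = "{- int N..int N}"
      have rest: "(\<integral>\<^sup>+i. ennreal (g (nat \<bar>i\<bar>)) \<partial>walk_pmf V m) \<le> ennreal (\<Sum>i\<in>?B. g 0 * pmf (walk_pmf V m) i)" for m
      proof -
        have "(\<integral>\<^sup>+i. ennreal (g (nat \<bar>i\<bar>)) \<partial>walk_pmf V m) \<le> (\<integral>\<^sup>+i. ennreal (g 0) * indicator ?B i \<partial>walk_pmf V m)"
          using zero le by (intro nn_integral_mono) (auto simp: indicator_def intro!: ennreal_leI)
        also have "\<dots> = ennreal (g 0) * emeasure (walk_pmf V m) ?B"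
          by (subst nn_integral_cmult_indicator) auto
        also have "\<dots> = ennreal (\<Sum>i\<in>?B. g 0 * pmf (walk_pmf V m) i)"
          using nonneg[of 0] by (simp add: measure_pmf.emeasure_eq_measure measure_measure_pmf_finite
              sum_distrib_left[symmetric] ennreal_mult')
        finally show ?thesis .
      qed
      have "(\<lambda>m. \<Sum>i\<in>?B. g 0 * pmf (walk_pmf V m) i) \<longlonglongrightarrow> (\<Sum>i\<in>?B. g 0 * 0)"
        by (intro tendsto_intros lim)
      then have "(\<lambda>m. ennreal (\<Sum>i\<in>?B. g 0 * pmf (walk_pmf V m) i)) \<longlonglongrightarrow> 0"
        using tendsto_ennrealI by fastforce
      moreover have "(\<lambda>m. \<Sum>n<m. ennreal (pmf (walk_pmf V n) 0)) \<longlonglongrightarrow> ?G"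
        by (intro summable_LIMSEQ) simp
      ultimately have "(\<lambda>m. (\<Sum>n<m. ennreal (pmf (walk_pmf V n) 0)) + ennreal (\<Sum>i\<in>?B. g 0 * pmf (walk_pmf V m) i)) \<longlonglongrightarrow> ?G + 0"
        by (intro tendsto_add)
      moreover have "ennreal (g 0) \<le> (\<Sum>n<m. ennreal (pmf (walk_pmf V n) 0)) + ennreal (\<Sum>i\<in>?B. g 0 * pmf (walk_pmf V m) i)" for m
        using expected_visits_lower_bound[where u="\<lambda>i. ennreal (g (nat \<bar>i\<bar>))" and V=V and m=m, OF sub] rest[of m]
        by (auto elim: order_trans intro: add_left_mono)
      ultimately have "ennreal (g 0) \<le> ?G + 0"
        by (intro tendsto_lowerbound[where F=sequentially]) auto
      then show ?thesis
        by (simp add: g_def lessThan_atLeast0)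
    qed
    then show ?thesis
      by (intro suminf_le_const) auto
  qed simp
qed


section \<open>Averaging over the renewal process\<close>

text \<open>Only the increments of \<open>\<tau>\<close> are given as random variables; the points themselves are
  measurable as their partial sums.\<close>

lemma prob_space_renewal_law:
  assumes "prob_space M" and "renewal_process M \<tau> \<alpha> L"
  shows "prob_space (renewal_law M \<tau>)"
proof -
  interpret prob_space M by fact
  have "(\<lambda>x. \<tau> i x) \<in> measurable M (count_space UNIV)" for i
  proof (induction i)
    case 0
    have "(\<lambda>x. \<tau> 0 x) \<in> measurable M (count_space UNIV) \<longleftrightarrow> (\<lambda>x. 0::nat) \<in> measurable M (count_space UNIV)"
      using assms(2) by (intro measurable_cong) (auto simp: renewal_process_def)
    then show ?case by simp
  next
    case (Suc i)
    have "indep_vars (\<lambda>_. count_space UNIV) (\<lambda>i x. \<tau> (Suc i) x - \<tau> i x) UNIV"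
      using assms(2) by (simp add: renewal_process_def)
    then have inc: "(\<lambda>x. \<tau> (Suc i) x - \<tau> i x) \<in> measurable M (count_space UNIV)"
      unfolding indep_vars_def by simp
    have "(\<lambda>x. \<tau> (Suc i) x) \<in> measurable M (count_space UNIV) \<longleftrightarrow>
        (\<lambda>x. (\<tau> (Suc i) x - \<tau> i x) + \<tau> i x) \<in> measurable M (count_space UNIV)"
      using assms(2) by (intro measurable_cong) (simp add: renewal_process_def less_imp_le)
    also have "\<dots>"
      using inc Suc by measurable
    finally show ?case .
  qed
  then have "(\<lambda>x i. \<tau> i x) \<in> measurable M (\<Pi>\<^sub>M i\<in>UNIV. count_space UNIV)"
    by (intro measurable_PiM_single') (auto simp: space_PiM)
  then show ?thesis
    unfolding renewal_law_def by (rule prob_space_distr)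
qed

lemma borel_measurable_pinning_weight:
  fixes P :: "(nat \<Rightarrow> nat) measure"
  assumes "sets P = sets (\<Pi>\<^sub>M i\<in>UNIV. count_space UNIV)"
  shows "(\<lambda>t. exp (\<Sum>i = 1..n. c i * indicator (range t) i) :: real) \<in> borel_measurable P"
proof -
  have [measurable_cong]: "sets P = sets (\<Pi>\<^sub>M i\<in>UNIV. count_space (UNIV :: nat set))" by fact
  have eq: "(\<lambda>t. indicator (range t) i :: real) = (\<lambda>t. if \<exists>j. t j = i then 1 else 0)" for i :: nat
    by (auto simp: indicator_def fun_eq_iff)
  have "(\<lambda>t. if \<exists>j. t j = i then 1 else 0 :: real) \<in> borel_measurable P" for i
    by measurable
  then have [measurable]: "(\<lambda>t. indicator (range t) i :: real) \<in> borel_measurable P" for i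
    by (simp only: eq)
  show ?thesis by measurable
qed

text \<open>Since \<open>n\<close> and \<open>w\<close> are fixed, the weight is bounded; hence the Bochner integral that
  defines the partition function agrees with the non-negative one, which commutes with sums. The
  convention for \<open>n = 0\<close> is consistent because the integrand is then 1 and \<open>P\<close> has mass 1.\<close>

lemma ennreal_pinning_Z:
  assumes "prob_space P" and sets: "sets P = sets (\<Pi>\<^sub>M i\<in>UNIV. count_space UNIV)"
  shows "ennreal (pinning_Z P \<beta> h w n) =
    (\<integral>\<^sup>+t. ennreal (exp (\<Sum>i = 1..n. (\<beta> * w i + h) * indicator (range t) i)) \<partial>P)"
proof -
  interpret prob_space P by fact
  let ?e = "\<lambda>t. exp (\<Sum>i = 1..n. (\<beta> * w i + h) * indicator (range t) i) :: real"
  have "integrable P ?e"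
  proof (rule integrable_const_bound[where B="exp (\<Sum>i = 1..n. \<bar>\<beta> * w i + h\<bar>)"])
    have "(\<beta> * w i + h) * indicator (range t) i \<le> \<bar>\<beta> * w i + h\<bar>" for t :: "nat \<Rightarrow> nat" and i
      by (cases "i \<in> range t") (simp_all add: abs_ge_self)
    then have "?e t \<le> exp (\<Sum>i = 1..n. \<bar>\<beta> * w i + h\<bar>)" for t :: "nat \<Rightarrow> nat"
      unfolding exp_le_cancel_iff by (intro sum_mono)
    then show "AE t in P. norm (?e t) \<le> exp (\<Sum>i = 1..n. \<bar>\<beta> * w i + h\<bar>)"
      by simp
  qed (rule borel_measurable_pinning_weight[OF sets])
  then have "(\<integral>\<^sup>+t. ennreal (?e t) \<partial>P) = ennreal (\<integral>t. ?e t \<partial>P)"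
    by (intro nn_integral_eq_integral) auto
  moreover have "pinning_Z P \<beta> h w n = (\<integral>t. ?e t \<partial>P)"
    by (cases "n = 0") (simp_all only: pinning_Z_def if_True if_False, simp add: prob_space)
  ultimately show ?thesis
    by (simp only:)
qed

lemma exp_sparse_potential:
  "exp (sparse_potential \<beta> h f w S (int n)) =
    exp (\<Sum>i = 1..n. (\<beta> * w i + h) * indicator S i) * exp (- f * real n)"
  by (simp add: sparse_potential_def symmetric_potential_def sum_subtractf exp_diff exp_minus
      divide_inverse add.commute mult.commute)

theorem proposition2:
  fixes M :: "'a measure"
    and \<tau> :: "nat \<Rightarrow> 'a \<Rightarrow> nat"
    and \<omega> :: "nat \<Rightarrow> 'a \<Rightarrow> real"
    and \<alpha> \<beta> h f :: real
    and L :: "real \<Rightarrow> real"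
  assumes "prob_space M"
    and "0 \<le> \<alpha>" and "slowly_varying L"
    and "renewal_process M \<tau> \<alpha> L"
    and "iid_disorder M \<omega>"
    and "independent_of_disorder M \<tau> \<omega>"
    and "0 \<le> \<beta>"
  shows "\<forall>x\<in>space M.
     (\<integral>\<^sup>+t. (\<integral>\<^sup>+X. visits_zero X \<partial>sparse_walk_law \<beta> h f (\<lambda>i. \<omega> i x) (range t)) \<partial>renewal_law M \<tau>)
       = grand_canonical_Z (renewal_law M \<tau>) \<beta> h (\<lambda>i. \<omega> i x) f"
proof
  fix x
  let ?P = "renewal_law M \<tau>" and ?w = "\<lambda>i. \<omega> i x"
  let ?e = "\<lambda>n t. exp (\<Sum>i = 1..n. (\<beta> * ?w i + h) * indicator (range t) i) :: real"
  have P: "prob_space ?P" "sets ?P = sets (\<Pi>\<^sub>M i\<in>UNIV. count_space UNIV)"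
    using prob_space_renewal_law[OF assms(1,4)] by (simp_all add: renewal_law_def)
  have e: "?e n \<in> borel_measurable ?P" for n
    by (rule borel_measurable_pinning_weight[OF P(2)])
  have "(\<integral>\<^sup>+X. visits_zero X \<partial>sparse_walk_law \<beta> h f ?w S) =
      (\<Sum>n. ennreal (exp (sparse_potential \<beta> h f ?w S (int n))))" for S
    unfolding sparse_walk_law_def sparse_potential_def
    by (rule expected_visits_zero[OF symmetric_potential_symmetric symmetric_potential_0])
  then have "(\<integral>\<^sup>+t. (\<integral>\<^sup>+X. visits_zero X \<partial>sparse_walk_law \<beta> h f ?w (range t)) \<partial>?P) =
      (\<integral>\<^sup>+t. (\<Sum>n. ennreal (?e n t) * ennreal (exp (- f * real n))) \<partial>?P)"
    by (simp only: exp_sparse_potential ennreal_mult' exp_ge_zero)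
  also have "\<dots> = (\<Sum>n. (\<integral>\<^sup>+t. ennreal (?e n t) \<partial>?P) * ennreal (exp (- f * real n)))"
  proof (subst nn_integral_suminf)
    show "(\<lambda>t. ennreal (?e n t) * ennreal (exp (- f * real n))) \<in> borel_measurable ?P" for n
      by (intro borel_measurable_times_ennreal measurable_compose[OF e measurable_ennreal]) simp
    have "(\<integral>\<^sup>+t. ennreal (?e n t) * ennreal (exp (- f * real n)) \<partial>?P) =
        (\<integral>\<^sup>+t. ennreal (?e n t) \<partial>?P) * ennreal (exp (- f * real n))" for n
      by (intro nn_integral_multc measurable_compose[OF e measurable_ennreal])
    then show "(\<Sum>n. \<integral>\<^sup>+t. ennreal (?e n t) * ennreal (exp (- f * real n)) \<partial>?P) =
        (\<Sum>n. (\<integral>\<^sup>+t. ennreal (?e n t) \<partial>?P) * ennreal (exp (- f * real n)))"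
      by (simp only:)
  qed
  also have "\<dots> = grand_canonical_Z ?P \<beta> h ?w f"
    unfolding grand_canonical_Z_def ennreal_pinning_Z[OF P, symmetric]
    by (simp only: ennreal_mult'' exp_ge_zero)
  finally show "(\<integral>\<^sup>+t. (\<integral>\<^sup>+X. visits_zero X \<partial>sparse_walk_law \<beta> h f ?w (range t)) \<partial>?P) =
      grand_canonical_Z ?P \<beta> h ?w f" .
qed

end
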